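(* Let $a,b>0$ be real with $a\neq b$, let $r,k$ be nonnegative integers, let $\bar\alpha_r=(\alpha_0,\dots,\alpha_{r-1})$ be a sequence of complex numbers with $\alpha_i\neq 1$ for all $i$, and let $x,y,z\in\mathbb{R}$. Then for every integer $n\ge 0$, $${}_{p}\mathbb{M}_{n}^{(r)}(x+z,y;k,a,b;\bar\alpha_{r})=\sum_{j=0}^{n}\binom{n}{j}\,\mathbb{M}_{j}^{(r)}(x;k,a,b;\bar\alpha_{r})\,p_{n-j}(z,y).$$
   Context: All generating functions are understood as formal power series in $t$ (with $b^t=e^{t\log b}$, $a^t=e^{t\log a}$). Fix a family of functions $\varphi_n(y)$ and the series $\varphi(y,t)=\sum_{n\ge0}\varphi_n(y)\frac{t^n}{n!}$ with $\varphi_0(y)\neq0$. The 2-variable general polynomials $p_n(x,y)$ are defined by $e^{xt}\varphi(y,t)=\sum_{n\ge 0}p_n(x,y)\frac{t^n}{n!}$, with $p_0(x,y)=1$. The unified family $\mathbb{M}_n^{(r)}(x;k,a,b;\bar\alpha_r)$ is defined by $$\sum_{n=0}^{\infty}\mathbb{M}_{n}^{(r)}(x;k,a,b;\bar\alpha_{r})\frac{t^{n}}{n!}=\frac{(-1)^{r}t^{rk}2^{r(1-k)}}{\prod_{i=0}^{r-1}(\alpha_{i}b^{t}-a^{t})}\,e^{xt}.$$ The 2-variable unified family ${}_{p}\mathbb{M}_{n}^{(r)}(x,y;k,a,b;\bar\alpha_r)$ of generalized Apostol-Euler, Bernoulli and Genocchi polynomials of order $r$ is defined by $$\sum_{n=0}^{\infty}{}_{p}\mathbb{M}_{n}^{(r)}(x,y;k,a,b;\bar\alpha_{r})\frac{t^{n}}{n!}=\frac{(-1)^{r}t^{rk}2^{r(1-k)}}{\prod_{i=0}^{r-1}(\alpha_{i}b^{t}-a^{t})}\,e^{xt}\varphi(y,t).$$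 The left subscript $p$ is only a label referring to the family $p_n(x,y)$. *)

theory Defs
  imports Complex_Main "HOL-Computational_Algebra.Formal_Power_Series"
begin

definition egf :: "(nat \<Rightarrow> complex) \<Rightarrow> complex fps" where
  "egf f = Abs_fps (\<lambda>n. f n / fact n)"

text \<open>Inverse of \<open>egf\<close>: it turns a generating function identity into a definition.\<close>

definition egf_coeff :: "complex fps \<Rightarrow> nat \<Rightarrow> complex" where
  "egf_coeff F n = fact n * fps_nth F n"

lemma egf_egf_coeff: "egf (egf_coeff F) = F"
  by (simp add: egf_def egf_coeff_def fps_eq_iff)

text \<open>The series of $c^t = e^{t \log c}$, used for $c > 0$.\<close>

definition fps_base_exp :: "real \<Rightarrow> complex fps" where
  "fps_base_exp c = fps_exp (complex_of_real (ln c))"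

definition phi_series :: "(nat \<Rightarrow> real \<Rightarrow> complex) \<Rightarrow> real \<Rightarrow> complex fps" where
  "phi_series \<phi> y = egf (\<lambda>n. \<phi> n y)"

text \<open>The 2-variable general polynomials $p_n(x,y)$.\<close>

definition gen_poly :: "(nat \<Rightarrow> real \<Rightarrow> complex) \<Rightarrow> nat \<Rightarrow> real \<Rightarrow> real \<Rightarrow> complex" where
  "gen_poly \<phi> n x y = egf_coeff (fps_exp (complex_of_real x) * phi_series \<phi> y) n"

text \<open>The exponent $r(1-k)$ may be negative, hence the integer power. Only the values
  \<open>\<alpha> i\<close> with \<open>i < r\<close> matter. The constant coefficient of the denominator is the product of
  the \<open>\<alpha> i - 1\<close>, so when no \<open>\<alpha> i\<close> is 1 the quotient is multiplication by the inverse power series.\<close>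

definition unified_kernel ::
    "nat \<Rightarrow> nat \<Rightarrow> real \<Rightarrow> real \<Rightarrow> (nat \<Rightarrow> complex) \<Rightarrow> complex fps" where
  "unified_kernel r k a b \<alpha> =
     (fps_const ((- 1) ^ r) * fps_X ^ (r * k) * fps_const (2 powi (int r * (1 - int k)))) /
     (\<Prod>i<r. fps_const (\<alpha> i) * fps_base_exp b - fps_base_exp a)"

text \<open>The unified family $\mathbb{M}_n^{(r)}(x;k,a,b;\bar\alpha_r)$.\<close>

definition unified_M ::
    "nat \<Rightarrow> nat \<Rightarrow> real \<Rightarrow> real \<Rightarrow> (nat \<Rightarrow> complex) \<Rightarrow> nat \<Rightarrow> real \<Rightarrow> complex" where
  "unified_M r k a b \<alpha> n x =
     egf_coeff (unified_kernel r k a b \<alpha> * fps_exp (complex_of_real x)) n"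

text \<open>The 2-variable unified family ${}_p\mathbb{M}_n^{(r)}(x,y;k,a,b;\bar\alpha_r)$.\<close>

definition unified_pM ::
    "(nat \<Rightarrow> real \<Rightarrow> complex) \<Rightarrow> nat \<Rightarrow> nat \<Rightarrow> real \<Rightarrow> real \<Rightarrow> (nat \<Rightarrow> complex) \<Rightarrow>
     nat \<Rightarrow> real \<Rightarrow> real \<Rightarrow> complex" where
  "unified_pM \<phi> r k a b \<alpha> n x y =
     egf_coeff (unified_kernel r k a b \<alpha> * fps_exp (complex_of_real x) * phi_series \<phi> y) n"

end

theory Submission
  imports Defs
begin

text \<open>The addition formula comes from splitting one series into two factors. Since
  \<open>e^((x+z)t) = e^(xt) e^(zt)\<close>, the generating function of the left-hand side is the
  generating function of the unified family at \<open>x\<close> times \<open>e^(zt) \<phi>(y,t)\<close>, the generating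
  function of the general polynomials at \<open>z\<close>; comparing coefficients of \<open>t^n/n!\<close> gives the
  binomial sum.\<close>

text \<open>The weights \<open>n!\<close> turn the Cauchy product of ordinary coefficients into a binomial
  convolution, because \<open>n! / (j! (n-j)!)\<close> is a binomial coefficient.\<close>

lemma egf_coeff_mult:
  "egf_coeff (F * G) n =
    (\<Sum>j=0..n. of_nat (n choose j) * egf_coeff F j * egf_coeff G (n - j))"
  unfolding egf_coeff_def fps_mult_nth sum_distrib_left
  by (intro sum.cong refl) (simp add: binomial_fact)

theorem theorem3p2:
  fixes \<phi> :: "nat \<Rightarrow> real \<Rightarrow> complex"
    and a b :: real and r k :: nat and \<alpha> :: "nat \<Rightarrow> complex"
    and x y z :: real and n :: nat
  assumes "\<And>u. \<phi> 0 u \<noteq> 0"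
    and "\<And>v u. gen_poly \<phi> 0 v u = 1"
    and "a > 0" and "b > 0" and "a \<noteq> b"
    and "\<And>i. i < r \<Longrightarrow> \<alpha> i \<noteq> 1"
  shows "unified_pM \<phi> r k a b \<alpha> n (x + z) y =
    (\<Sum>j=0..n. of_nat (n choose j) * unified_M r k a b \<alpha> j x * gen_poly \<phi> (n - j) z y)"
proof -
  let ?K = "unified_kernel r k a b \<alpha>"
  have "?K * fps_exp (complex_of_real (x + z)) * phi_series \<phi> y =
      (?K * fps_exp (complex_of_real x)) * (fps_exp (complex_of_real z) * phi_series \<phi> y)"
    by (simp add: fps_exp_add_mult mult.assoc)
  then show ?thesis
    unfolding unified_pM_def unified_M_def gen_poly_def by (simp only: egf_coeff_mult)
qed

end
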